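(* Let $\Sigma=(X,X_0,S,U,\to,Y,h)$ be a total NFTS, $K$ a positive integer, and $\Sigma_V$ the verification system of $\Sigma$. Then $\Sigma$ is not $K$-step opaque if and only if there exist $x_{V,0}\in X_{V,0}$, $n\ge0$, inputs $(u_0^1,u_0^2),\dots,(u_{n-1}^1,u_{n-1}^2)\in U_V$ and a sequence of transitions $x_{V,0}\xrightarrow{(u_0^1,u_0^2)}_V\cdots\xrightarrow{(u_{n-1}^1,u_{n-1}^2)}_V(q^1,q^2)$ in $\Sigma_V$ such that $\emptyset\neq q^1\cap q^2\subseteq S$ and the number of indices $i\in\{0,\dots,n-1\}$ with $u_i^2\neq\epsilon$ is at most $K$.
   Context: An NFTS is a tuple $\Sigma=(X,X_0,S,U,\to,Y,h)$ with $X$ a finite set of states, $X_0\subseteq X$ initial states, $S\subseteq X$ secret states, $U$ a finite set of inputs, $\to\subseteq X\times U\times X$ the transition relation (write $x\xrightarrow{u}x'$), $Y$ a set of outputs and $h:X\to Y$. It is total if for every $x\in X$, $u\in U$ there is $x'$ with $x\xrightarrow{u}x'$. For $\alpha=\alpha(0)\cdots\alpha(|\alpha|-1)\in U^*$ (finite sequences, including empty), a run over $\alpha$ is a nonempty sequence $x_0\dots x_k$ with $k\le|\alpha|$, $x_0\in X_0$, $(x_j,\alpha(j),x_{j+1})\in\to$ for $j<k$. $\Sigma$ is $K$-step opaque if for every $\alpha\in U^*$, every run $x_0\dots x_{|\alpha|}$ over $\alpha$ and every $i$ with $\max\{0,|\alpha|-K\}\le i\le|\alpha|$ and $x_i\in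 S$, there is a run $x_0'\dots x'_{|\alpha|}$ over $\alpha$ with $x_i'\notin S$ and $h(x_j)=h(x_j')$ for all $j\in\{0,\dots,|\alpha|\}$. For $y\in Y$ let $X_y=\{x\mid h(x)=y\}$, $X_{0,y}=X_0\cap X_y$; for $q\subseteq X$, $u\in U$, $\mathrm{suc}(q,u)=\{x\mid\exists x'\in q,(x',u,x)\in\to\}$, $\mathrm{post}(q,u)=\{x\mid\exists x'\in q,(x,u,x')\in\to\}$. Let $\epsilon\notin U$. The verification system $\Sigma_V$ has input set $U_V=(U\times\{\epsilon\})\cup(\{\epsilon\}\times U)$, initial states $X_{V,0}=\{(X_{0,y_1},X_{y_2})\mid y_1,y_2\in Y,\ X_{0,y_1}\neq\emptyset,\ X_{y_2}\neq\emptyset\}$, and transitions on pairs of subsets of $X$: $(q_1,q_2)\xrightarrow{(u,\epsilon)}_V(q_1',q_2)$ iff $q_1'=\mathrm{suc}(q_1,u)\cap X_y\neq\emptyset$ for some $y\in Y$, and $(q_1,q_2)\xrightarrow{(\epsilon,u)}_V(q_1,q_2')$ iff $q_2'=\mathrm{post}(q_2,u)\cap X_y\neq\emptyset$ for some $y\in Y$. *)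

theory Defs
  imports Main
begin

record ('x, 'u) ts =
  ts_states :: "'x set"
  ts_init :: "'x set"
  ts_inputs :: "'u set"
  ts_trans :: "('x \<times> 'u \<times> 'x) set"

record ('x, 'u, 'y) nfts = "('x, 'u) ts" +
  secret :: "'x set"
  outputs :: "'y set"
  outmap :: "'x \<Rightarrow> 'y"

definition is_nfts :: "('x, 'u, 'y) nfts \<Rightarrow> bool" where
  "is_nfts \<Sigma> \<longleftrightarrow>
     finite (ts_states \<Sigma>) \<and>
     ts_init \<Sigma> \<subseteq> ts_states \<Sigma> \<and>
     secret \<Sigma> \<subseteq> ts_states \<Sigma> \<and>
     finite (ts_inputs \<Sigma>) \<and>
     ts_trans \<Sigma> \<subseteq> ts_states \<Sigma> \<times> ts_inputs \<Sigma> \<times> ts_states \<Sigma> \<and>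
     outmap \<Sigma> ` ts_states \<Sigma> \<subseteq> outputs \<Sigma>"

definition total_nfts :: "('x, 'u, 'y) nfts \<Rightarrow> bool" where
  "total_nfts \<Sigma> \<longleftrightarrow>
     (\<forall>x \<in> ts_states \<Sigma>. \<forall>u \<in> ts_inputs \<Sigma>. \<exists>x' \<in> ts_states \<Sigma>. (x, u, x') \<in> ts_trans \<Sigma>)"

text \<open>A run \<open>x\<^sub>0 \<dots> x\<^sub>k\<close> is the list of its \<open>k + 1\<close> states, so \<open>k \<le> length \<alpha>\<close> reads
  \<open>length xs \<le> length \<alpha> + 1\<close>.\<close>

definition is_run :: "('x, 'u, 'y) nfts \<Rightarrow> 'u list \<Rightarrow> 'x list \<Rightarrow> bool" where
  "is_run \<Sigma> \<alpha> xs \<longleftrightarrow>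
     xs \<noteq> [] \<and> length xs \<le> length \<alpha> + 1 \<and> xs ! 0 \<in> ts_init \<Sigma> \<and>
     (\<forall>j. j + 1 < length xs \<longrightarrow> (xs ! j, \<alpha> ! j, xs ! (j + 1)) \<in> ts_trans \<Sigma>)"

text \<open>The truncated subtraction \<open>length \<alpha> - K\<close> is \<open>max {0, |\<alpha>| - K}\<close>.\<close>

definition K_step_opaque :: "nat \<Rightarrow> ('x, 'u, 'y) nfts \<Rightarrow> bool" where
  "K_step_opaque K \<Sigma> \<longleftrightarrow>
     (\<forall>\<alpha> \<in> lists (ts_inputs \<Sigma>). \<forall>xs. is_run \<Sigma> \<alpha> xs \<and> length xs = length \<alpha> + 1 \<longrightarrow>
        (\<forall>i. length \<alpha> - K \<le> i \<and> i \<le> length \<alpha> \<and> xs ! i \<in> secret \<Sigma> \<longrightarrow>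
           (\<exists>xs'. is_run \<Sigma> \<alpha> xs' \<and> length xs' = length \<alpha> + 1 \<and> xs' ! i \<notin> secret \<Sigma> \<and>
              (\<forall>j \<le> length \<alpha>. outmap \<Sigma> (xs ! j) = outmap \<Sigma> (xs' ! j)))))"

definition X_out :: "('x, 'u, 'y) nfts \<Rightarrow> 'y \<Rightarrow> 'x set" where
  "X_out \<Sigma> y = {x \<in> ts_states \<Sigma>. outmap \<Sigma> x = y}"

definition X0_out :: "('x, 'u, 'y) nfts \<Rightarrow> 'y \<Rightarrow> 'x set" where
  "X0_out \<Sigma> y = ts_init \<Sigma> \<inter> X_out \<Sigma> y"

definition suc_set :: "('x, 'u, 'y) nfts \<Rightarrow> 'x set \<Rightarrow> 'u \<Rightarrow> 'x set" where
  "suc_set \<Sigma> q u = {x \<in> ts_states \<Sigma>. \<exists>x' \<in> q. (x', u, x) \<in> ts_trans \<Sigma>}"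

text \<open>Despite its name, \<open>post\<close> collects the predecessors of \<open>q\<close> under \<open>u\<close>.\<close>

definition post_set :: "('x, 'u, 'y) nfts \<Rightarrow> 'x set \<Rightarrow> 'u \<Rightarrow> 'x set" where
  "post_set \<Sigma> q u = {x \<in> ts_states \<Sigma>. \<exists>x' \<in> q. (x, u, x') \<in> ts_trans \<Sigma>}"

text \<open>The symbol \<open>\<epsilon> \<notin> U\<close> is \<open>None\<close>, and \<open>u \<in> U\<close> is embedded as \<open>Some u\<close>.\<close>

definition verification_system ::
  "('x, 'u, 'y) nfts \<Rightarrow> ('x set \<times> 'x set, 'u option \<times> 'u option) ts" where
  "verification_system \<Sigma> =
    \<lparr> ts_states = Pow (ts_states \<Sigma>) \<times> Pow (ts_states \<Sigma>),
      ts_init = {(X0_out \<Sigma> y1, X_out \<Sigma> y2) | y1 y2.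
                   y1 \<in> outputs \<Sigma> \<and> y2 \<in> outputs \<Sigma> \<and> X0_out \<Sigma> y1 \<noteq> {} \<and> X_out \<Sigma> y2 \<noteq> {}},
      ts_inputs = (Some ` ts_inputs \<Sigma> \<times> {None}) \<union> ({None} \<times> Some ` ts_inputs \<Sigma>),
      ts_trans =
        {((q1, q2), (Some u, None), (q1', q2)) | q1 q2 u q1'.
           q1 \<subseteq> ts_states \<Sigma> \<and> q2 \<subseteq> ts_states \<Sigma> \<and> u \<in> ts_inputs \<Sigma> \<and>
           (\<exists>y \<in> outputs \<Sigma>. q1' = suc_set \<Sigma> q1 u \<inter> X_out \<Sigma> y \<and> q1' \<noteq> {})} \<union>
        {((q1, q2), (None, Some u), (q1, q2')) | q1 q2 u q2'.
           q1 \<subseteq> ts_states \<Sigma> \<and> q2 \<subseteq> ts_states \<Sigma> \<and> u \<in> ts_inputs \<Sigma> \<and>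
           (\<exists>y \<in> outputs \<Sigma>. q2' = post_set \<Sigma> q2 u \<inter> X_out \<Sigma> y \<and> q2' \<noteq> {})} \<rparr>"

end

theory Submission
  imports Defs
begin

text \<open>
  Fix an input sequence, an output sequence and a position in it. The first component of a state
  of the verification system is the set of endpoints of runs producing the observation up to that
  position, the second one the set of starting points of paths producing the observation from that
  position on. Gluing paths at a common state shows that the intersection of the two is exactly
  the set of states which a run with the whole observation can occupy at that position. Opacity is
  violated iff some such set is nonempty and consists of secret states; the steps in the second
  component count how far the position lies in the past.
\<close>

section \<open>Observed paths and state estimates\<close>

text \<open>Words, observations and paths are functions on \<^typ>\<open>nat\<close> of which only an initial segment
  matters.\<close>

definition observed_path ::
  "('x, 'u, 'y) nfts \<Rightarrow> (nat \<Rightarrow> 'u) \<Rightarrow> (nat \<Rightarrow> 'y) \<Rightarrow> nat \<Rightarrow> (nat \<Rightarrow> 'x) \<Rightarrow> bool" where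
  "observed_path \<Sigma> a y k r \<longleftrightarrow>
     (\<forall>j<k. (r j, a j, r (Suc j)) \<in> ts_trans \<Sigma>) \<and> (\<forall>j\<le>k. r j \<in> X_out \<Sigma> (y j))"

definition current_states ::
  "('x, 'u, 'y) nfts \<Rightarrow> (nat \<Rightarrow> 'u) \<Rightarrow> (nat \<Rightarrow> 'y) \<Rightarrow> nat \<Rightarrow> 'x set" where
  "current_states \<Sigma> a y k = {r k | r. r 0 \<in> ts_init \<Sigma> \<and> observed_path \<Sigma> a y k r}"

text \<open>The path stands for the tail of a run, so its first state ranges over all states. This
  is the current-state estimate of the reversed system with every state initial.\<close>

definition start_states ::
  "('x, 'u, 'y) nfts \<Rightarrow> (nat \<Rightarrow> 'u) \<Rightarrow> (nat \<Rightarrow> 'y) \<Rightarrow> nat \<Rightarrow> 'x set" where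
  "start_states \<Sigma> a y k = {r 0 | r. observed_path \<Sigma> a y k r}"

lemma observed_path_cong:
  assumes "\<And>j. j < k \<Longrightarrow> a j = a' j" and "\<And>j. j \<le> k \<Longrightarrow> y j = y' j"
    and "\<And>j. j \<le> k \<Longrightarrow> r j = r' j"
  shows "observed_path \<Sigma> a y k r \<longleftrightarrow> observed_path \<Sigma> a' y' k r'"
  using assms unfolding observed_path_def by auto

lemma current_states_cong:
  assumes "\<And>j. j < k \<Longrightarrow> a j = a' j" and "\<And>j. j \<le> k \<Longrightarrow> y j = y' j"
  shows "current_states \<Sigma> a y k = current_states \<Sigma> a' y' k"
proof -
  have "observed_path \<Sigma> a y k r \<longleftrightarrow> observed_path \<Sigma> a' y' k r" for r
    by (rule observed_path_cong) (use assms in auto)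
  then show ?thesis by (simp add: current_states_def)
qed

lemma observed_path_snoc:
  "observed_path \<Sigma> a y (Suc k) r \<longleftrightarrow>
     observed_path \<Sigma> a y k r \<and> (r k, a k, r (Suc k)) \<in> ts_trans \<Sigma> \<and> r (Suc k) \<in> X_out \<Sigma> (y (Suc k))"
  unfolding observed_path_def by (auto simp: less_Suc_eq le_Suc_eq)

text \<open>Both parts check the state \<open>r m\<close> against \<open>y m\<close>; this overlap
  is where paths are glued later.\<close>

lemma observed_path_append:
  "observed_path \<Sigma> a y (m + k) r \<longleftrightarrow>
     observed_path \<Sigma> a y m r \<and>
     observed_path \<Sigma> (\<lambda>j. a (m + j)) (\<lambda>j. y (m + j)) k (\<lambda>j. r (m + j))"
proof (induction k)
  case 0
  then show ?case by (auto simp: observed_path_def)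
next
  case (Suc k)
  then show ?case by (auto simp: observed_path_snoc)
qed

lemma observed_path_Cons:
  "observed_path \<Sigma> a y (Suc k) r \<longleftrightarrow>
     r 0 \<in> X_out \<Sigma> (y 0) \<and> (r 0, a 0, r (Suc 0)) \<in> ts_trans \<Sigma> \<and>
     observed_path \<Sigma> (\<lambda>j. a (Suc j)) (\<lambda>j. y (Suc j)) k (\<lambda>j. r (Suc j))"
  using observed_path_append[of \<Sigma> a y 1 k r] by (auto simp: observed_path_def le_Suc_eq)

section \<open>Recursions for the estimates\<close>

lemma current_states_0: "current_states \<Sigma> a y 0 = X0_out \<Sigma> (y 0)"
proof
  show "X0_out \<Sigma> (y 0) \<subseteq> current_states \<Sigma> a y 0"
  proof
    fix x assume "x \<in> X0_out \<Sigma> (y 0)"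
    then show "x \<in> current_states \<Sigma> a y 0"
      unfolding current_states_def observed_path_def X0_out_def by (auto intro!: exI[of _ "\<lambda>_. x"])
  qed
qed (auto simp: current_states_def observed_path_def X0_out_def)

lemma start_states_0: "start_states \<Sigma> a y 0 = X_out \<Sigma> (y 0)"
proof
  show "X_out \<Sigma> (y 0) \<subseteq> start_states \<Sigma> a y 0"
  proof
    fix x assume "x \<in> X_out \<Sigma> (y 0)"
    then show "x \<in> start_states \<Sigma> a y 0"
      unfolding start_states_def observed_path_def by (auto intro!: exI[of _ "\<lambda>_. x"])
  qed
qed (auto simp: start_states_def observed_path_def)

text \<open>A path of length \<open>k\<close> may be changed freely at index \<open>Suc k\<close>,
  so any successor with the right output extends it. The right-hand side is what a transition with
  input \<open>(Some u, None)\<close> puts into the first component.\<close>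

lemma current_states_Suc:
  "current_states \<Sigma> a y (Suc k) =
     suc_set \<Sigma> (current_states \<Sigma> a y k) (a k) \<inter> X_out \<Sigma> (y (Suc k))" (is "?L = ?R")
proof
  show "?L \<subseteq> ?R"
    unfolding current_states_def suc_set_def observed_path_snoc by (auto simp: X_out_def)
  show "?R \<subseteq> ?L"
  proof
    fix x assume "x \<in> ?R"
    then obtain r where r: "r 0 \<in> ts_init \<Sigma>" "observed_path \<Sigma> a y k r"
      "(r k, a k, x) \<in> ts_trans \<Sigma>" "x \<in> X_out \<Sigma> (y (Suc k))"
      unfolding current_states_def suc_set_def by auto
    have "observed_path \<Sigma> a y k (r(Suc k := x))"
      using r(2) observed_path_cong[of k a a y y r "r(Suc k := x)"] by auto
    with r have "observed_path \<Sigma> a y (Suc k) (r(Suc k := x))"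
      by (simp add: observed_path_snoc)
    with r(1) show "x \<in> ?L"
      unfolding current_states_def by (auto intro!: exI[of _ "r(Suc k := x)"])
  qed
qed

text \<open>Paths grow at the front: \<open>case_nat x r\<close> puts \<open>x\<close> before
  \<open>r\<close>, while word and observation shift by one. Hence the second component of the
  verification system reads the observation from its end backwards.\<close>

lemma start_states_Suc:
  "start_states \<Sigma> a y (Suc k) =
     post_set \<Sigma> (start_states \<Sigma> (\<lambda>j. a (Suc j)) (\<lambda>j. y (Suc j)) k) (a 0) \<inter> X_out \<Sigma> (y 0)"
  (is "?L = ?R")
proof
  show "?L \<subseteq> ?R"
    unfolding start_states_def post_set_def observed_path_Cons by (fastforce simp: X_out_def)
  show "?R \<subseteq> ?L"
  proof
    fix x assume "x \<in> ?R"
    then obtain r where "x \<in> X_out \<Sigma> (y 0)" "(x, a 0, r 0) \<in> ts_trans \<Sigma>"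
      "observed_path \<Sigma> (\<lambda>j. a (Suc j)) (\<lambda>j. y (Suc j)) k r"
      unfolding start_states_def post_set_def by auto
    then have "observed_path \<Sigma> a y (Suc k) (case_nat x r)"
      by (simp add: observed_path_Cons)
    then show "x \<in> ?L"
      unfolding start_states_def by (auto intro!: exI[of _ "case_nat x r"])
  qed
qed

text \<open>What can follow depends only on the state reached, so paths can be cut at
  \<open>m\<close> and any two meeting there can be joined. The two estimates together lose no
  information about position \<open>m\<close>.\<close>

lemma current_states_Int_start_states:
  "current_states \<Sigma> a y m \<inter> start_states \<Sigma> (\<lambda>j. a (m + j)) (\<lambda>j. y (m + j)) k =
     {r m | r. r 0 \<in> ts_init \<Sigma> \<and> observed_path \<Sigma> a y (m + k) r}" (is "?L = ?R")
proof
  show "?R \<subseteq> ?L"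
  proof
    fix x assume "x \<in> ?R"
    then obtain r where "x = r m" "r 0 \<in> ts_init \<Sigma>" "observed_path \<Sigma> a y (m + k) r"
      by blast
    then show "x \<in> ?L"
      unfolding current_states_def start_states_def observed_path_append
      by (auto intro: exI[of _ r] exI[of _ "\<lambda>j. r (m + j)"])
  qed
  show "?L \<subseteq> ?R"
  proof
    fix x assume "x \<in> ?L"
    then obtain r s where r: "x = r m" "r 0 \<in> ts_init \<Sigma>" "observed_path \<Sigma> a y m r"
      and s: "x = s 0" "observed_path \<Sigma> (\<lambda>j. a (m + j)) (\<lambda>j. y (m + j)) k s"
      unfolding current_states_def start_states_def by blast
    \<comment> \<open>Index \<open>m\<close> is taken from \<open>r\<close>; since
      \<open>r m = x = s 0\<close>, the equation \<open>t (m + j) = s j\<close> holds at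
      \<open>j = 0\<close> as well.\<close>
    define t where "t j = (if j \<le> m then r j else s (j - m))" for j
    have "t (m + j) = s j" for j
      using r(1) s(1) by (cases j) (auto simp: t_def)
    moreover have "observed_path \<Sigma> a y m t"
      using r(3) observed_path_cong[of m a a y y r t] by (simp add: t_def)
    ultimately have "observed_path \<Sigma> a y (m + k) t"
      using s(2) by (simp add: observed_path_append)
    moreover have "t m = x" "t 0 \<in> ts_init \<Sigma>"
      using r by (auto simp: t_def)
    ultimately show "x \<in> ?R" by blast
  qed
qed

section \<open>Opacity in terms of observed paths\<close>

lemma observed_path_inputs:
  assumes "is_nfts \<Sigma>" and "observed_path \<Sigma> a y k r" and "j < k"
  shows "a j \<in> ts_inputs \<Sigma>"
  using assms unfolding is_nfts_def observed_path_def by blast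

text \<open>\<open>X_out\<close> demands membership in \<open>ts_states\<close>; initial states have
  it and transitions preserve it. Leaving \<open>y\<close> general lets the lemma apply also to a
  second run with the observation of a first one.\<close>

lemma is_run_observed_path:
  assumes "is_nfts \<Sigma>" and "is_run \<Sigma> \<alpha> xs" and "length xs = length \<alpha> + 1"
    and "\<And>j. j \<le> length \<alpha> \<Longrightarrow> y j = outmap \<Sigma> (xs ! j)"
  shows "observed_path \<Sigma> ((!) \<alpha>) y (length \<alpha>) ((!) xs)"
proof -
  have tr: "(xs ! j, \<alpha> ! j, xs ! Suc j) \<in> ts_trans \<Sigma>" if "j < length \<alpha>" for j
    using assms(2,3) that by (simp add: is_run_def)
  have "xs ! j \<in> ts_states \<Sigma>" if "j \<le> length \<alpha>" for j
  proof (cases j)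
    case 0
    then show ?thesis using assms(1,2) by (auto simp: is_run_def is_nfts_def)
  next
    case (Suc i)
    then show ?thesis using tr[of i] that assms(1) by (auto simp: is_nfts_def)
  qed
  with tr assms(4) show ?thesis by (auto simp: observed_path_def X_out_def)
qed

lemma is_run_of_observed_path:
  assumes "observed_path \<Sigma> a y k r" and "r 0 \<in> ts_init \<Sigma>"
  shows "is_run \<Sigma> (map a [0..<k]) (map r [0..<Suc k])"
  using assms by (auto simp: is_run_def observed_path_def nth_map[of 0] simp del: upt_Suc)

text \<open>A nonempty set inside \<open>secret \<Sigma>\<close> means that the observation does
  occur and that every run producing it is secret at position \<open>m\<close>. The delay
  \<open>k\<close> counts the inputs after that position.\<close>

lemma not_K_step_opaque_iff:
  assumes "is_nfts \<Sigma>"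
  shows "\<not> K_step_opaque K \<Sigma> \<longleftrightarrow>
    (\<exists>a y m k. k \<le> K \<and>
       {r m | r. r 0 \<in> ts_init \<Sigma> \<and> observed_path \<Sigma> a y (m + k) r} \<noteq> {} \<and>
       {r m | r. r 0 \<in> ts_init \<Sigma> \<and> observed_path \<Sigma> a y (m + k) r} \<subseteq> secret \<Sigma>)"
    (is "_ \<longleftrightarrow> (\<exists>a y m k. ?V a y m k)")
proof
  assume "\<not> K_step_opaque K \<Sigma>"
  then obtain \<alpha> xs i where run: "is_run \<Sigma> \<alpha> xs" "length xs = length \<alpha> + 1"
    and i: "length \<alpha> - K \<le> i" "i \<le> length \<alpha>"
    and sec: "\<And>xs'. \<lbrakk>is_run \<Sigma> \<alpha> xs'; length xs' = length \<alpha> + 1;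
      \<forall>j\<le>length \<alpha>. outmap \<Sigma> (xs ! j) = outmap \<Sigma> (xs' ! j)\<rbrakk> \<Longrightarrow> xs' ! i \<in> secret \<Sigma>"
    unfolding K_step_opaque_def by blast
  let ?y = "\<lambda>j. outmap \<Sigma> (xs ! j)"
  \<comment> \<open>With truncated subtraction, \<open>length \<alpha> - K \<le> i\<close> is the
    same as \<open>length \<alpha> - i \<le> K\<close>.\<close>
  define k where "k = length \<alpha> - i"
  have ik: "i + k = length \<alpha>" "k \<le> K" using i by (auto simp: k_def)
  have "observed_path \<Sigma> ((!) \<alpha>) ?y (length \<alpha>) ((!) xs)" "xs ! 0 \<in> ts_init \<Sigma>"
    using is_run_observed_path[OF assms run] run by (auto simp: is_run_def)
  \<comment> \<open>Listed as a sequence of states, such a path is a run with the outputs of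
    \<open>xs\<close>, and the failure of opacity forces it to be secret at
    \<open>i\<close>.\<close>
  moreover have "r i \<in> secret \<Sigma>"
    if "r 0 \<in> ts_init \<Sigma>" and r: "observed_path \<Sigma> ((!) \<alpha>) ?y (length \<alpha>) r" for r
  proof -
    have nth: "map r [0..<Suc (length \<alpha>)] ! j = r j" if "j \<le> length \<alpha>" for j
      using that by (simp del: upt_Suc)
    have "is_run \<Sigma> \<alpha> (map r [0..<Suc (length \<alpha>)])"
      using is_run_of_observed_path[OF r that(1)] by (simp add: map_nth del: upt_Suc)
    moreover have "\<forall>j\<le>length \<alpha>. outmap \<Sigma> (xs ! j) = outmap \<Sigma> (map r [0..<Suc (length \<alpha>)] ! j)"
      using r by (simp add: nth observed_path_def X_out_def del: upt_Suc)
    ultimately show ?thesis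
      using sec[of "map r [0..<Suc (length \<alpha>)]"] nth[OF i(2)] by (simp del: upt_Suc)
  qed
  ultimately have "?V ((!) \<alpha>) ?y i k" using ik by auto
  then show "\<exists>a y m k. ?V a y m k" by blast
next
  assume "\<exists>a y m k. ?V a y m k"
  then obtain a y m k where V: "?V a y m k" by (elim exE)
  then have k: "k \<le> K"
    and sec: "\<And>s. \<lbrakk>s 0 \<in> ts_init \<Sigma>; observed_path \<Sigma> a y (m + k) s\<rbrakk> \<Longrightarrow> s m \<in> secret \<Sigma>"
    by auto
  from V obtain r where r: "r 0 \<in> ts_init \<Sigma>" "observed_path \<Sigma> a y (m + k) r" by auto
  let ?\<alpha> = "map a [0..<m + k]" and ?xs = "map r [0..<Suc (m + k)]"
  have nth: "?xs ! j = r j" if "j \<le> m + k" for j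
    using that by (simp del: upt_Suc)
  have y: "y j = outmap \<Sigma> (r j)" if "j \<le> m + k" for j
    using that r(2) by (simp add: observed_path_def X_out_def)
  show "\<not> K_step_opaque K \<Sigma>"
  proof
    assume "K_step_opaque K \<Sigma>"
    moreover have "?\<alpha> \<in> lists (ts_inputs \<Sigma>)"
      using observed_path_inputs[OF assms r(2)] by (auto simp del: upt_Suc)
    moreover have "is_run \<Sigma> ?\<alpha> ?xs" "length ?xs = length ?\<alpha> + 1"
      using is_run_of_observed_path[OF r(2,1)] by simp_all
    moreover have "length ?\<alpha> - K \<le> m" "m \<le> length ?\<alpha>" "?xs ! m \<in> secret \<Sigma>"
      using k sec[OF r] nth[of m] by (simp_all del: upt_Suc)
    ultimately obtain xs' where xs': "is_run \<Sigma> ?\<alpha> xs'" "length xs' = length ?\<alpha> + 1"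
      "xs' ! m \<notin> secret \<Sigma>" "\<forall>j\<le>length ?\<alpha>. outmap \<Sigma> (?xs ! j) = outmap \<Sigma> (xs' ! j)"
      unfolding K_step_opaque_def by blast
    have "y j = outmap \<Sigma> (xs' ! j)" if "j \<le> length ?\<alpha>" for j
      using that xs'(4) y[of j] nth[of j] by (simp del: upt_Suc)
    from is_run_observed_path[OF assms xs'(1,2) this]
    have "observed_path \<Sigma> ((!) ?\<alpha>) y (m + k) ((!) xs')" by simp
    \<comment> \<open>\<open>(!) ?\<alpha>\<close> and \<open>a\<close> agree below
      \<open>m + k\<close>, which is all that a path of this length reads.\<close>
    then have "observed_path \<Sigma> a y (m + k) ((!) xs')"
      using observed_path_cong[of "m + k" "(!) ?\<alpha>" a y y "(!) xs'" "(!) xs'"] by simp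
    then show False
      using sec[of "(!) xs'"] xs'(1,3) by (simp add: is_run_def)
  qed
qed

section \<open>Paths of the verification system\<close>

lemma current_states_subset: "current_states \<Sigma> a y k \<subseteq> ts_states \<Sigma>"
  unfolding current_states_def observed_path_def X_out_def by auto

lemma start_states_subset: "start_states \<Sigma> a y k \<subseteq> ts_states \<Sigma>"
  unfolding start_states_def observed_path_def X_out_def by auto

lemma verification_system_trans_cases:
  assumes "(v, w, v') \<in> ts_trans (verification_system \<Sigma>)"
  obtains (fwd) q1 q2 u y where "v = (q1, q2)" "w = (Some u, None)"
      "v' = (suc_set \<Sigma> q1 u \<inter> X_out \<Sigma> y, q2)"
    | (bwd) q1 q2 u y where "v = (q1, q2)" "w = (None, Some u)"
      "v' = (q1, post_set \<Sigma> q2 u \<inter> X_out \<Sigma> y)"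
  using assms unfolding verification_system_def ts.simps
  by (elim UnE CollectE exE conjE bexE) (use that in simp_all)

text \<open>Forward and backward steps may interleave in any order, so the components are described
  by independent words and observations. Whether these fit together is decided only once the
  components share a state.\<close>

lemma verification_system_path_sound:
  assumes "v 0 \<in> ts_init (verification_system \<Sigma>)"
    and "\<forall>i<n. (v i, w i, v (Suc i)) \<in> ts_trans (verification_system \<Sigma>)"
  shows "\<exists>a y m b z. v n =
    (current_states \<Sigma> a y m, start_states \<Sigma> b z (card {i. i < n \<and> snd (w i) \<noteq> None}))"
  using assms(2)
proof (induction n)
  case 0
  from assms(1) obtain y1 y2 where "v 0 = (X0_out \<Sigma> y1, X_out \<Sigma> y2)"
    unfolding verification_system_def by auto
  \<comment> \<open>A path of length 0 reads no input, so \<open>undefined\<close> can serve as the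
    word.\<close>
  then have "v 0 = (current_states \<Sigma> undefined (\<lambda>_. y1) 0, start_states \<Sigma> undefined (\<lambda>_. y2) 0)"
    by (simp add: current_states_0 start_states_0)
  then show ?case by (intro exI) simp
next
  case (Suc n)
  let ?I = "\<lambda>n. {i. i < n \<and> snd (w i) \<noteq> None}"
  from Suc obtain a y m b z
    where vn: "v n = (current_states \<Sigma> a y m, start_states \<Sigma> b z (card (?I n)))"
    by auto
  from Suc.prems have "(v n, w n, v (Suc n)) \<in> ts_trans (verification_system \<Sigma>)" by simp
  then show ?case
  proof (cases rule: verification_system_trans_cases)
    case (fwd q1 q2 u y')
    have "?I (Suc n) = ?I n" using fwd(2) by (auto simp: less_Suc_eq)
    \<comment> \<open>The estimate at \<open>m\<close> reads \<open>a\<close> below \<open>m\<close>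
      and \<open>y\<close> up to \<open>m\<close>, so the new input and output go into fresh
      places.\<close>
    moreover have "current_states \<Sigma> (a(m := u)) (y(Suc m := y')) m = current_states \<Sigma> a y m"
      by (rule current_states_cong) auto
    then have "current_states \<Sigma> (a(m := u)) (y(Suc m := y')) (Suc m) = fst (v (Suc n))"
      using fwd vn by (simp add: current_states_Suc)
    ultimately have "v (Suc n) = (current_states \<Sigma> (a(m := u)) (y(Suc m := y')) (Suc m),
        start_states \<Sigma> b z (card (?I (Suc n))))"
      using fwd vn by simp
    then show ?thesis by blast
  next
    case (bwd q1 q2 u y')
    have "?I (Suc n) = insert n (?I n)" using bwd(2) by (auto simp: less_Suc_eq)
    then have "card (?I (Suc n)) = Suc (card (?I n))" by simp
    \<comment> \<open>A backward step prepends its input and output to those already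
      guessed.\<close>
    then have "v (Suc n) = (current_states \<Sigma> a y m,
        start_states \<Sigma> (case_nat u b) (case_nat y' z) (card (?I (Suc n))))"
      using bwd vn by (simp add: start_states_Suc)
    then show ?thesis by blast
  qed
qed

lemma verification_system_init:
  assumes "is_nfts \<Sigma>" and "X0_out \<Sigma> y \<noteq> {}" and "X_out \<Sigma> y' \<noteq> {}"
  shows "(X0_out \<Sigma> y, X_out \<Sigma> y') \<in> ts_init (verification_system \<Sigma>)"
proof -
  have "y \<in> outputs \<Sigma>" "y' \<in> outputs \<Sigma>"
    using assms by (auto simp: is_nfts_def X0_out_def X_out_def)
  with assms show ?thesis unfolding verification_system_def by auto
qed

lemma verification_system_fwd:
  assumes "is_nfts \<Sigma>" and "q1 \<subseteq> ts_states \<Sigma>" and "q2 \<subseteq> ts_states \<Sigma>" and "u \<in> ts_inputs \<Sigma>"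
    and "suc_set \<Sigma> q1 u \<inter> X_out \<Sigma> y \<noteq> {}"
  shows "((q1, q2), (Some u, None), (suc_set \<Sigma> q1 u \<inter> X_out \<Sigma> y, q2))
    \<in> ts_trans (verification_system \<Sigma>)"
proof -
  have "y \<in> outputs \<Sigma>" using assms(1,5) by (auto simp: is_nfts_def X_out_def)
  with assms show ?thesis unfolding verification_system_def by auto
qed

lemma verification_system_bwd:
  assumes "is_nfts \<Sigma>" and "q1 \<subseteq> ts_states \<Sigma>" and "q2 \<subseteq> ts_states \<Sigma>" and "u \<in> ts_inputs \<Sigma>"
    and "post_set \<Sigma> q2 u \<inter> X_out \<Sigma> y \<noteq> {}"
  shows "((q1, q2), (None, Some u), (q1, post_set \<Sigma> q2 u \<inter> X_out \<Sigma> y))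
    \<in> ts_trans (verification_system \<Sigma>)"
proof -
  have "y \<in> outputs \<Sigma>" using assms(1,5) by (auto simp: is_nfts_def X_out_def)
  with assms show ?thesis unfolding verification_system_def by auto
qed

text \<open>All \<open>m\<close> forward steps are taken first, then \<open>k\<close> backward ones.
  Prefixes and suffixes of \<open>r\<close> witness that every set on the way is nonempty, as the
  transitions demand.\<close>

lemma verification_system_path_complete:
  assumes nfts: "is_nfts \<Sigma>" and r: "r 0 \<in> ts_init \<Sigma>" "observed_path \<Sigma> a y (m + k) r"
  shows "\<exists>v w. v 0 \<in> ts_init (verification_system \<Sigma>) \<and>
    (\<forall>i<m + k. w i \<in> ts_inputs (verification_system \<Sigma>)) \<and>
    (\<forall>i<m + k. (v i, w i, v (Suc i)) \<in> ts_trans (verification_system \<Sigma>)) \<and>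
    v (m + k) = (current_states \<Sigma> a y m,
      start_states \<Sigma> (\<lambda>j. a (m + j)) (\<lambda>j. y (m + j)) k) \<and>
    card {i. i < m + k \<and> snd (w i) \<noteq> None} = k"
proof -
  let ?C = "current_states \<Sigma> a y"
  \<comment> \<open>The second component after \<open>t\<close> backward steps: it covers the last
    \<open>t\<close> inputs.\<close>
  define F where "F t = start_states \<Sigma> (\<lambda>j. a (m + k - t + j)) (\<lambda>j. y (m + k - t + j)) t" for t
  \<comment> \<open>\<open>min\<close> freezes the first component after step \<open>m\<close>;
    truncated subtraction keeps the second at \<open>F 0\<close> until then.\<close>
  define v where "v i = (?C (min i m), F (i - m))" for i
  define w where "w i = (if i < m then (Some (a i), None) else (None, Some (a (m + k - Suc (i - m)))))"
    for i
  have C_ne: "?C i \<noteq> {}" if "i \<le> m" for i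
  proof -
    have "observed_path \<Sigma> a y i r"
      using r(2) that observed_path_append[of \<Sigma> a y i "m + k - i" r] by simp
    with r(1) show ?thesis unfolding current_states_def by blast
  qed
  have F_ne: "F t \<noteq> {}" if "t \<le> k" for t
  proof -
    have "observed_path \<Sigma> (\<lambda>j. a (m + k - t + j)) (\<lambda>j. y (m + k - t + j)) t (\<lambda>j. r (m + k - t + j))"
      using r(2) that observed_path_append[of \<Sigma> a y "m + k - t" t r] by simp
    then show ?thesis unfolding F_def start_states_def by blast
  qed
  have F_Suc: "F (Suc t) = post_set \<Sigma> (F t) (a (m + k - Suc t)) \<inter> X_out \<Sigma> (y (m + k - Suc t))"
    if "t < k" for t
  proof -
    \<comment> \<open>Since \<open>t < k\<close>, the subtraction of \<open>Suc t\<close> is not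
      truncated and moving the start back by one is undone by \<open>Suc j\<close>.\<close>
    have "m + k - Suc t + Suc j = m + k - t + j" for j using that by simp
    then show ?thesis unfolding F_def start_states_Suc by (simp only: add_0_right)
  qed
  have F_sub: "F t \<subseteq> ts_states \<Sigma>" for t unfolding F_def by (rule start_states_subset)
  have inp: "a j \<in> ts_inputs \<Sigma>" if "j < m + k" for j
    using observed_path_inputs[OF nfts r(2) that] .
  have "v 0 \<in> ts_init (verification_system \<Sigma>)"
    using verification_system_init[OF nfts, of "y 0" "y (m + k)"] C_ne[of 0] F_ne[of 0]
    by (simp add: v_def F_def current_states_0 start_states_0)
  moreover have "\<forall>i<m + k. w i \<in> ts_inputs (verification_system \<Sigma>)"
    using inp by (auto simp: w_def verification_system_def)
  moreover have "(v i, w i, v (Suc i)) \<in> ts_trans (verification_system \<Sigma>)" if "i < m + k" for i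
  proof (cases "i < m")
    case True
    then have "((?C i, F 0), (Some (a i), None), (?C (Suc i), F 0)) \<in> ts_trans (verification_system \<Sigma>)"
      using C_ne[of "Suc i"] verification_system_fwd[OF nfts current_states_subset F_sub inp[OF that]]
      unfolding current_states_Suc by simp
    with True show ?thesis by (simp add: v_def w_def min_def)
  next
    case False
    with that have t: "i - m < k" "Suc i - m = Suc (i - m)" by auto
    then have "((?C m, F (i - m)), (None, Some (a (m + k - Suc (i - m)))), (?C m, F (Suc (i - m))))
      \<in> ts_trans (verification_system \<Sigma>)"
      using F_ne[of "Suc (i - m)"] verification_system_bwd[OF nfts current_states_subset F_sub inp]
      unfolding F_Suc[OF t(1)] by simp
    moreover have "min i m = m" "min (Suc i) m = m" using False by auto
    ultimately show ?thesis using False by (simp only: v_def w_def t(2) if_False)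
  qed
  moreover have "v (m + k) = (?C m, start_states \<Sigma> (\<lambda>j. a (m + j)) (\<lambda>j. y (m + j)) k)"
    by (simp add: v_def F_def)
  moreover have "{i. i < m + k \<and> snd (w i) \<noteq> None} = {m..<m + k}"
    by (auto simp: w_def)
  then have "card {i. i < m + k \<and> snd (w i) \<noteq> None} = k" by simp
  ultimately show ?thesis by (intro exI[of _ v] exI[of _ w] conjI allI impI) simp_all
qed

section \<open>Violation of opacity as reachability in the verification system\<close>

theorem theorem5p6:
  fixes \<Sigma> :: "('x, 'u, 'y) nfts" and K :: nat
  assumes "is_nfts \<Sigma>" and "total_nfts \<Sigma>" and "K > 0"
  shows "\<not> K_step_opaque K \<Sigma> \<longleftrightarrow>
    (\<exists>(n :: nat) (v :: nat \<Rightarrow> 'x set \<times> 'x set) (w :: nat \<Rightarrow> 'u option \<times> 'u option) q1 q2.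
       v 0 \<in> ts_init (verification_system \<Sigma>) \<and>
       (\<forall>i<n. w i \<in> ts_inputs (verification_system \<Sigma>)) \<and>
       (\<forall>i<n. (v i, w i, v (Suc i)) \<in> ts_trans (verification_system \<Sigma>)) \<and>
       v n = (q1, q2) \<and>
       q1 \<inter> q2 \<noteq> {} \<and> q1 \<inter> q2 \<subseteq> secret \<Sigma> \<and>
       card {i. i < n \<and> snd (w i) \<noteq> None} \<le> K)"
    (is "_ \<longleftrightarrow> ?R")
proof
  assume "\<not> K_step_opaque K \<Sigma>"
  then obtain a y m k where k: "k \<le> K"
    and V: "{r m | r. r 0 \<in> ts_init \<Sigma> \<and> observed_path \<Sigma> a y (m + k) r} \<noteq> {}"
      "{r m | r. r 0 \<in> ts_init \<Sigma> \<and> observed_path \<Sigma> a y (m + k) r} \<subseteq> secret \<Sigma>"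
    unfolding not_K_step_opaque_iff[OF assms(1)] by blast
  from V(1) obtain r where "r 0 \<in> ts_init \<Sigma>" "observed_path \<Sigma> a y (m + k) r" by blast
  from verification_system_path_complete[OF assms(1) this] obtain v w where
    "v 0 \<in> ts_init (verification_system \<Sigma>)"
    "\<forall>i<m + k. w i \<in> ts_inputs (verification_system \<Sigma>)"
    "\<forall>i<m + k. (v i, w i, v (Suc i)) \<in> ts_trans (verification_system \<Sigma>)"
    "v (m + k) = (current_states \<Sigma> a y m, start_states \<Sigma> (\<lambda>j. a (m + j)) (\<lambda>j. y (m + j)) k)"
    "card {i. i < m + k \<and> snd (w i) \<noteq> None} = k"
    by blast
  with k V[folded current_states_Int_start_states] show ?R
    by (intro exI[of _ "m + k"] exI[of _ v] exI[of _ w]) simp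
next
  assume ?R
  then obtain n v w q1 q2 where v: "v 0 \<in> ts_init (verification_system \<Sigma>)"
    "\<forall>i<n. (v i, w i, v (Suc i)) \<in> ts_trans (verification_system \<Sigma>)" "v n = (q1, q2)"
    and q: "q1 \<inter> q2 \<noteq> {}" "q1 \<inter> q2 \<subseteq> secret \<Sigma>"
    and card: "card {i. i < n \<and> snd (w i) \<noteq> None} \<le> K"
    by blast
  define k where "k = card {i. i < n \<and> snd (w i) \<noteq> None}"
  from verification_system_path_sound[OF v(1,2)] v(3) obtain a y m b z
    where q12: "q1 = current_states \<Sigma> a y m" "q2 = start_states \<Sigma> b z k"
    unfolding k_def by auto
  \<comment> \<open>A common state has a single output, so the two independent observations agree
    where they meet.\<close>
  from q(1) q12 obtain x where "x \<in> X_out \<Sigma> (y m)" "x \<in> X_out \<Sigma> (z 0)"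
    unfolding current_states_def start_states_def observed_path_def by force
  then have yz: "y m = z 0" by (simp add: X_out_def)
  \<comment> \<open>Word and observation are concatenated at \<open>m\<close>. There
    \<open>o'\<close> takes the value \<open>z 0\<close>, which equals \<open>y m\<close> by
    \<open>yz\<close>, so both estimates survive the change.\<close>
  define c where "c j = (if j < m then a j else b (j - m))" for j
  define o' where "o' j = (if j < m then y j else z (j - m))" for j
  have "q1 = current_states \<Sigma> c o' m"
    unfolding q12 by (rule current_states_cong) (use yz in \<open>auto simp: c_def o'_def\<close>)
  moreover have "q2 = start_states \<Sigma> (\<lambda>j. c (m + j)) (\<lambda>j. o' (m + j)) k"
    unfolding q12 by (simp add: c_def o'_def)
  ultimately have "q1 \<inter> q2 = {r m | r. r 0 \<in> ts_init \<Sigma> \<and> observed_path \<Sigma> c o' (m + k) r}"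
    by (simp add: current_states_Int_start_states)
  with q card[folded k_def] show "\<not> K_step_opaque K \<Sigma>"
    unfolding not_K_step_opaque_iff[OF assms(1)]
    by (intro exI[of _ c] exI[of _ o'] exI[of _ m] exI[of _ k]) simp
qed

end
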